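(* For any polynomial $P\in\mathbb{H}[x]$ it holds that $$R(P')\subseteq \bigcup_{I\in\mathcal{S}} \Bigl(\mathbf{conv}\bigl(R(P_I)\bigr)\cap \mathbf{conv}\bigl(R(P_I^{\perp})\bigr)\Bigr).$$
   Context: $\mathbb{H}$ is the real algebra of quaternions $h=\alpha_0+\alpha_1 i+\alpha_2 j+\alpha_3 k$ ($\alpha_0,\dots,\alpha_3\in\mathbb{R}$) with $i^2=j^2=k^2=ijk=-1$, with $\mathrm{Re}(h)=\alpha_0$ and conjugate $\overline{h}=\alpha_0-\alpha_1 i-\alpha_2 j-\alpha_3 k$, equipped with the standard Euclidean scalar product on $\mathbb{R}^4$ in the basis $1,i,j,k$; orthogonality is with respect to it. $\mathcal{S}=\{h\in\mathbb{H} : h\overline{h}=1,\ \mathrm{Re}(h)=0\}$ is the imaginary unit sphere. For $I\in\mathcal{S}$, $\mathbb{R}[I]=\{a+Ib : a,b\in\mathbb{R}\}\subseteq\mathbb{H}$ is the plane generated by $1$ and $I$. A polynomial $P\in\mathbb{H}[x]$ is a formal expression $P(x)=\sum_{t=0}^n a_t x^t$ with $a_t\in\mathbb{H}$ (coefficients on the left), evaluated at $h\in\mathbb{H}$ by $P(h)=\sum_{t=0}^n a_t h^t$. Its derivative is $P'(x)=\sum_{t=1}^n t\,a_t x^{t-1}$, and $R(P')=\{h\in\mathbb{H} : P'(h)=0\}$ is the set of roots of $P'$. For $I\in\mathcal{S}$ let $b_t$ be the orthogonal projection of $a_t$ on $\mathbb{R}[I]$ and let $b_t^\perp=a_t-b_t$.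 Put $P_I(x)=\sum_{t=0}^n b_t x^t$ and $P_I^\perp(x)=\sum_{t=0}^n b_t^\perp x^t$, both restricted to the plane $\mathbb{R}[I]$, so that $R(P_I)=\{h\in\mathbb{R}[I] : P_I(h)=0\}$ and $R(P_I^\perp)=\{h\in\mathbb{R}[I] : P_I^\perp(h)=0\}$. For $E\subseteq\mathbb{H}$, $\mathbf{conv}(E)$ denotes the convex hull of $E$.
   Formalization: Whenever P_I (or P_I^⊥) is a nonzero constant polynomial, conv(R(P_I)) (or conv(R(P_I^⊥))) is read as the whole plane R[I] instead of the empty set; read literally the inclusion is false, e.g. for P=1, or for P=j(x−i)^2+1 at the root i of P'. *)

theory Defs
  imports "HOL-Analysis.Analysis" "HOL-Computational_Algebra.Polynomial"
begin

section \<open>The real algebra of quaternions\<close>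

codatatype quat = Quat (qRe: real) (qIm1: real) (qIm2: real) (qIm3: real)

lemma quat_eq_iff:
  "x = y \<longleftrightarrow> qRe x = qRe y \<and> qIm1 x = qIm1 y \<and> qIm2 x = qIm2 y \<and> qIm3 x = qIm3 y"
  by (auto intro: quat.expand)

instantiation quat :: ab_group_add
begin

primcorec zero_quat where
  "qRe 0 = 0" | "qIm1 0 = 0" | "qIm2 0 = 0" | "qIm3 0 = 0"

primcorec plus_quat where
  "qRe (x + y) = qRe x + qRe y"
| "qIm1 (x + y) = qIm1 x + qIm1 y"
| "qIm2 (x + y) = qIm2 x + qIm2 y"
| "qIm3 (x + y) = qIm3 x + qIm3 y"

primcorec uminus_quat where
  "qRe (- x) = - qRe x"
| "qIm1 (- x) = - qIm1 x"
| "qIm2 (- x) = - qIm2 x"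
| "qIm3 (- x) = - qIm3 x"

primcorec minus_quat where
  "qRe (x - y) = qRe x - qRe y"
| "qIm1 (x - y) = qIm1 x - qIm1 y"
| "qIm2 (x - y) = qIm2 x - qIm2 y"
| "qIm3 (x - y) = qIm3 x - qIm3 y"

instance
  by standard (simp_all add: quat_eq_iff)

end

instantiation quat :: ring_1
begin

primcorec one_quat where
  "qRe 1 = 1" | "qIm1 1 = 0" | "qIm2 1 = 0" | "qIm3 1 = 0"

primcorec times_quat where
  "qRe (x * y) = qRe x * qRe y - qIm1 x * qIm1 y - qIm2 x * qIm2 y - qIm3 x * qIm3 y"
| "qIm1 (x * y) = qRe x * qIm1 y + qIm1 x * qRe y + qIm2 x * qIm3 y - qIm3 x * qIm2 y"
| "qIm2 (x * y) = qRe x * qIm2 y - qIm1 x * qIm3 y + qIm2 x * qRe y + qIm3 x * qIm1 y"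
| "qIm3 (x * y) = qRe x * qIm3 y + qIm1 x * qIm2 y - qIm2 x * qIm1 y + qIm3 x * qRe y"

instance
  by standard (simp_all add: quat_eq_iff algebra_simps)

end

instantiation quat :: real_algebra_1
begin

primcorec scaleR_quat where
  "qRe (scaleR r x) = r * qRe x"
| "qIm1 (scaleR r x) = r * qIm1 x"
| "qIm2 (scaleR r x) = r * qIm2 x"
| "qIm3 (scaleR r x) = r * qIm3 x"

instance
  by standard (simp_all add: quat_eq_iff algebra_simps)

end

text \<open>The Euclidean scalar product of the basis \<open>1, i, j, k\<close>, with its norm and topology.\<close>

instantiation quat :: real_inner
begin

definition inner_quat :: "quat \<Rightarrow> quat \<Rightarrow> real" where
  "inner_quat x y = qRe x * qRe y + qIm1 x * qIm1 y + qIm2 x * qIm2 y + qIm3 x * qIm3 y"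

definition norm_quat :: "quat \<Rightarrow> real" where
  "norm_quat x = sqrt (inner x x)"

definition sgn_quat :: "quat \<Rightarrow> quat" where
  "sgn_quat x = x /\<^sub>R norm x"

definition dist_quat :: "quat \<Rightarrow> quat \<Rightarrow> real" where
  "dist_quat x y = norm (x - y)"

definition uniformity_quat :: "(quat \<times> quat) filter" where
  "uniformity_quat = (INF e\<in>{0 <..}. principal {(x, y). dist x y < e})"

definition open_quat :: "quat set \<Rightarrow> bool" where
  "open_quat U \<longleftrightarrow> (\<forall>x\<in>U. eventually (\<lambda>(x', y). x' = x \<longrightarrow> y \<in> U) uniformity)"

instance
proof
  fix x y z :: quat and r :: real and U :: "quat set"
  show "inner x x = 0 \<longleftrightarrow> x = 0"
    by (simp add: inner_quat_def quat_eq_iff add_nonneg_eq_0_iff)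
qed (simp_all add: inner_quat_def norm_quat_def sgn_quat_def dist_quat_def
      uniformity_quat_def open_quat_def algebra_simps)

end

definition quat_i :: quat where "quat_i = Quat 0 1 0 0"
definition quat_j :: quat where "quat_j = Quat 0 0 1 0"
definition quat_k :: quat where "quat_k = Quat 0 0 0 1"

lemma quat_expand:
  "h = of_real (qRe h) + of_real (qIm1 h) * quat_i + of_real (qIm2 h) * quat_j
     + of_real (qIm3 h) * quat_k"
  by (simp add: quat_eq_iff quat_i_def quat_j_def quat_k_def of_real_def)

lemma quat_relations:
  "quat_i * quat_i = - 1" "quat_j * quat_j = - 1" "quat_k * quat_k = - 1"
  "quat_i * quat_j * quat_k = - 1"
  by (simp_all add: quat_eq_iff quat_i_def quat_j_def quat_k_def)

primcorec qcnj :: "quat \<Rightarrow> quat" where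
  "qRe (qcnj h) = qRe h"
| "qIm1 (qcnj h) = - qIm1 h"
| "qIm2 (qcnj h) = - qIm2 h"
| "qIm3 (qcnj h) = - qIm3 h"

definition imag_sphere :: "quat set" where
  "imag_sphere = {h. h * qcnj h = 1 \<and> qRe h = 0}"

definition qplane :: "quat \<Rightarrow> quat set" where
  "qplane I = {of_real a + I * of_real b | a b. True}"

definition qproj :: "quat \<Rightarrow> quat \<Rightarrow> quat" where
  "qproj I a = (THE b. b \<in> qplane I \<and> (\<forall>c\<in>qplane I. orthogonal (a - b) c))"

lemma qproj_eq:
  assumes "I \<in> imag_sphere"
  shows "qproj I a = of_real (inner a 1) + I * of_real (inner a I)"
proof -
  have I: "qRe I = 0" "inner I I = 1"
    using assms by (auto simp: imag_sphere_def quat_eq_iff inner_quat_def)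
  have vec: "of_real s + I * of_real t = s *\<^sub>R 1 + t *\<^sub>R I" for s t :: real
    by (simp add: of_real_def)
  have comp: "inner 1 (1::quat) = 1" "inner I 1 = 0" "inner 1 I = 0" "inner I I = 1"
    using I by (simp_all add: inner_quat_def)
  show ?thesis
    unfolding qproj_def
  proof (rule the_equality)
    let ?b = "of_real (inner a 1) + I * of_real (inner a I)"
    have "orthogonal (a - ?b) (of_real s + I * of_real t)" for s t
      by (simp add: vec orthogonal_def inner_diff_left inner_add_left inner_add_right comp)
    then show "?b \<in> qplane I \<and> (\<forall>c\<in>qplane I. orthogonal (a - ?b) c)"
      by (auto simp: qplane_def)
  next
    fix b assume b: "b \<in> qplane I \<and> (\<forall>c\<in>qplane I. orthogonal (a - b) c)"
    then obtain s t where st: "b = of_real s + I * of_real t"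
      by (auto simp: qplane_def)
    have "1 \<in> qplane I"
      unfolding qplane_def by (rule CollectI, rule exI[of _ 1], rule exI[of _ 0]) simp
    moreover have "I \<in> qplane I"
      unfolding qplane_def by (rule CollectI, rule exI[of _ 0], rule exI[of _ 1]) simp
    ultimately have "inner (a - b) 1 = 0" "inner (a - b) I = 0"
      using b by (auto simp: orthogonal_def)
    then show "b = of_real (inner a 1) + I * of_real (inner a I)"
      by (simp add: st vec inner_diff_left inner_add_left comp)
  qed
qed


section \<open>Quaternionic polynomials\<close>

text \<open>
  A formal polynomial with coefficients on the left is an element of the type \<open>quat poly\<close>.
  The library operations \<open>poly\<close> and \<open>pderiv\<close> need commutative coefficients, hence the
  following two definitions.
\<close>

definition qeval :: "quat poly \<Rightarrow> quat \<Rightarrow> quat" where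
  "qeval P h = (\<Sum>t\<le>degree P. coeff P t * h ^ t)"

definition qderiv :: "quat poly \<Rightarrow> quat poly" where
  "qderiv P = (\<Sum>t=1..degree P. monom (of_nat t * coeff P t) (t - 1))"

definition qroots :: "quat poly \<Rightarrow> quat set" where
  "qroots P = {h. qeval P h = 0}"

definition qpar :: "quat \<Rightarrow> quat poly \<Rightarrow> quat poly" where
  "qpar I P = map_poly (qproj I) P"

definition qperp :: "quat \<Rightarrow> quat poly \<Rightarrow> quat poly" where
  "qperp I P = map_poly (\<lambda>a. a - qproj I a) P"

definition plane_roots :: "quat \<Rightarrow> quat poly \<Rightarrow> quat set" where
  "plane_roots I Q = {h \<in> qplane I. qeval Q h = 0}"

text \<open>
  The convex hull of the roots in the plane of \<open>I\<close>, with the usual convention of the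
  Gauss--Lucas theorem for a nonzero constant \<open>Q\<close>: there the root set is empty although the
  derivative vanishes everywhere, and the hull is read as the whole plane, as it is for
  \<open>Q = 0\<close>.  The lemma \<open>hull_convention_needed\<close> shows that the
  convention cannot be dropped, even for non-constant \<open>P\<close>.
\<close>

definition root_hull :: "quat \<Rightarrow> quat poly \<Rightarrow> quat set" where
  "root_hull I Q =
     (if degree Q = 0 \<and> Q \<noteq> 0 then qplane I else convex hull (plane_roots I Q))"

lemma hull_convention_needed:
  fixes P :: "quat poly"
  defines "P \<equiv> [:1 - quat_j, 2 * quat_k, quat_j:]" \<comment> \<open>\<open>j (x - i)\<^sup>2 + 1\<close>, expanded\<close>
  shows "\<not> qroots (qderiv P) \<subseteq>
           (\<Union>I\<in>imag_sphere. convex hull (plane_roots I (qpar I P))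
                             \<inter> convex hull (plane_roots I (qperp I P)))"
proof
  assume sub: "qroots (qderiv P) \<subseteq>
           (\<Union>I\<in>imag_sphere. convex hull (plane_roots I (qpar I P))
                             \<inter> convex hull (plane_roots I (qperp I P)))"
  have deg: "degree P = 2"
    by (simp add: P_def quat_j_def quat_eq_iff)
  have "qderiv P = monom (2 * quat_k) 0 + monom (2 * quat_j) 1"
    by (simp add: qderiv_def deg numeral_2_eq_2) (simp add: P_def)
  also have "\<dots> = [:2 * quat_k, 2 * quat_j:]"
    by (simp add: monom_altdef monom_0 monom_Suc)
  finally have "qeval (qderiv P) quat_i = 0"
    by (simp add: qeval_def quat_eq_iff quat_i_def quat_j_def quat_k_def mult_2)
  then obtain I where I: "I \<in> imag_sphere"
    and hull: "quat_i \<in> convex hull (plane_roots I (qpar I P))"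
    using sub by (auto simp: qroots_def)
  have "convex (qplane I)"
    unfolding convex_def
  proof (intro ballI allI impI)
    fix x y and u v :: real
    assume "x \<in> qplane I" "y \<in> qplane I"
    then obtain a b c d where "x = of_real a + I * of_real b" "y = of_real c + I * of_real d"
      by (auto simp: qplane_def)
    then have "u *\<^sub>R x + v *\<^sub>R y = of_real (u * a + v * c) + I * of_real (u * b + v * d)"
      by (simp add: quat_eq_iff of_real_def algebra_simps)
    then show "u *\<^sub>R x + v *\<^sub>R y \<in> qplane I"
      unfolding qplane_def by blast
  qed
  then have "convex hull (plane_roots I (qpar I P)) \<subseteq> qplane I"
    by (intro hull_minimal) (auto simp: plane_roots_def)
  then obtain a b where "quat_i = of_real a + I * of_real b"
    using hull by (auto simp: qplane_def)
  then have "1 = qIm1 I * b" "0 = qIm2 I * b" "0 = qIm3 I * b"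
    by (simp_all add: quat_eq_iff quat_i_def of_real_def algebra_simps)
  then have im: "qRe I = 0" "qIm2 I = 0" "qIm3 I = 0"
    using I by (auto simp: imag_sphere_def)
  have "qproj I (1 - quat_j) = 1" "qproj I (2 * quat_k) = 0" "qproj I quat_j = 0"
    by (simp_all add: qproj_eq[OF I] inner_quat_def im quat_j_def quat_k_def mult_2)
  moreover have "qproj I 0 = 0"
    by (simp add: qproj_eq[OF I])
  ultimately have "qpar I P = [:1:]"
    by (intro poly_eqI) (auto simp: qpar_def P_def coeff_map_poly coeff_pCons split: nat.split)
  then have "plane_roots I (qpar I P) = {}"
    by (simp add: plane_roots_def qeval_def)
  then show False
    using hull by simp
qed

end

theory Submission
  imports Defs "HOL-Computational_Algebra.Fundamental_Theorem_Algebra"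
begin

text \<open>
  Every quaternion \<open>h\<close> lies in some plane \<open>\<real>[I]\<close>, a copy of \<open>\<complex>\<close>. For a unit \<open>J\<close>
  orthogonal to \<open>1\<close> and \<open>I\<close> we have \<open>\<real>[I]\<^sup>\<bottom> = J \<real>[I]\<close>, so \<open>P = p + J q\<close> on this plane,
  where \<open>p = P\<^sub>I\<close> and \<open>J q = P\<^sub>I\<^sup>\<bottom>\<close> for complex polynomials \<open>p\<close> and \<open>q\<close>.
  Since the sum \<open>\<real>[I] + J \<real>[I]\<close> is direct, \<open>P'(h) = 0\<close> forces \<open>p'(h) = q'(h) = 0\<close>, and the
  Gauss--Lucas theorem applies to \<open>p\<close> and to \<open>q\<close>.
\<close>

section \<open>The Gauss--Lucas theorem\<close>

text \<open>The logarithmic derivative p'/p is the sum of 1 / (z - r) over the roots r with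
  multiplicity, and each term times \<open>a\<close> has positive real part. The induction splits
  off one root; the weak bound is what a constant cofactor still provides.\<close>

lemma Re_logderiv_half_plane:
  fixes p :: "complex poly"
  assumes "p \<noteq> 0" and "\<And>r. poly p r = 0 \<Longrightarrow> Re (a / (z - r)) > 0"
  shows "poly p z \<noteq> 0 \<and> Re (a * poly (pderiv p) z / poly p z) \<ge> 0
    \<and> (degree p > 0 \<longrightarrow> Re (a * poly (pderiv p) z / poly p z) > 0)"
  using assms
proof (induction "degree p" arbitrary: p)
  case 0
  then obtain c where "p = [:c:]"
    by (metis degree_eq_zeroE)
  with 0 show ?case
    by (auto simp: pderiv_pCons)
next
  case (Suc n)
  then have "\<not> constant (poly p)"
    by (simp add: constant_degree)
  then obtain r where r: "poly p r = 0"
    using fundamental_theorem_of_algebra by blast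
  then obtain q where p: "p = [:- r, 1:] * q"
    by (metis dvdE poly_eq_0_iff_dvd)
  have q: "q \<noteq> 0"
    using Suc.prems(1) p by auto
  have "degree p = Suc (degree q)"
    unfolding p using q by (subst degree_mult_eq) auto
  then have "n = degree q"
    using Suc.hyps(2) by simp
  from Suc.hyps(1)[OF this q] have IH: "poly q z \<noteq> 0"
    "Re (a * poly (pderiv q) z / poly q z) \<ge> 0"
    using Suc.prems(2) p by auto
  have pos: "Re (a / (z - r)) > 0"
    using Suc.prems(2) r .
  then have zr: "z - r \<noteq> 0"
    by auto
  have pz: "poly p z = (z - r) * poly q z"
    by (simp add: p algebra_simps)
  have "poly (pderiv p) z = poly q z + (z - r) * poly (pderiv q) z"
    unfolding p by (simp only: pderiv_mult) (simp add: pderiv_pCons algebra_simps)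
  then have "a * poly (pderiv p) z / poly p z
      = a / (z - r) + a * poly (pderiv q) z / poly q z"
    unfolding pz using zr IH(1) by (simp add: add_divide_distrib distrib_left mult.left_commute)
  with IH pos pz zr show ?case
    by simp
qed

text \<open>A point outside the hull is strictly separated from all roots by a line, so the
  preceding lemma keeps p'/p nonzero there.\<close>

theorem Gauss_Lucas:
  fixes p :: "complex poly"
  assumes deg: "degree p > 0" and z: "poly (pderiv p) z = 0"
  shows "z \<in> convex hull {r. poly p r = 0}"
proof (rule ccontr)
  assume nz: "z \<notin> convex hull {r. poly p r = 0}"
  have p: "p \<noteq> 0"
    using deg by auto
  have "closed (convex hull {r. poly p r = 0})"
    by (intro compact_imp_closed compact_convex_hull finite_imp_compact poly_roots_finite p)
  then obtain a b where ab: "inner a z < b" "\<And>x. x \<in> convex hull {r. poly p r = 0} \<Longrightarrow> b < inner a x"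
    using separating_hyperplane_closed_point[OF convex_convex_hull _ nz] by metis
  \<comment> \<open>Re (u / v) is the inner product of u and v divided by the squared modulus of v.
    Since \<open>a\<close> points from \<open>z\<close> towards the roots, \<open>- a\<close> makes
    it positive.\<close>
  have "Re (- a / (z - r)) > 0" if "poly p r = 0" for r
  proof -
    have "r \<in> convex hull {r. poly p r = 0}"
      using that by (simp add: hull_inc)
    then have lt: "inner a (z - r) < 0"
      using ab by (force simp: inner_diff_right)
    then have "z - r \<noteq> 0"
      by auto
    then have "(Re (z - r))\<^sup>2 + (Im (z - r))\<^sup>2 > 0"
      by (simp add: complex_eq_iff sum_power2_gt_zero_iff)
    moreover have "Re (- a / (z - r)) = - inner a (z - r) / ((Re (z - r))\<^sup>2 + (Im (z - r))\<^sup>2)"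
      by (simp add: Re_divide inner_complex_def diff_divide_distrib add_divide_distrib)
    ultimately show ?thesis
      using lt by (simp only: zero_less_divide_iff neg_0_less_iff_less simp_thms)
  qed
  from Re_logderiv_half_plane[OF p this] deg z show False
    by simp
qed

section \<open>Planes of quaternions as copies of the complex numbers\<close>

lemma imag_sphere_iff: "I \<in> imag_sphere \<longleftrightarrow> qRe I = 0 \<and> (qIm1 I)\<^sup>2 + (qIm2 I)\<^sup>2 + (qIm3 I)\<^sup>2 = 1"
  by (auto simp: imag_sphere_def quat_eq_iff power2_eq_square)

lemma imag_sphere_square: "I \<in> imag_sphere \<Longrightarrow> I * I = - 1"
  by (auto simp: imag_sphere_iff quat_eq_iff power2_eq_square)

definition plane_embed :: "quat \<Rightarrow> complex \<Rightarrow> quat" where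
  "plane_embed I z = of_real (Re z) + I * of_real (Im z)"

text \<open>Coordinates of the orthogonal projection, hence total on the quaternions; a left inverse
  of \<open>plane_embed I\<close> for imaginary units.\<close>

definition plane_coord :: "quat \<Rightarrow> quat \<Rightarrow> complex" where
  "plane_coord I a = Complex (inner a 1) (inner a I)"

lemma plane_coord_0 [simp]: "plane_coord I 0 = 0"
  by (simp add: plane_coord_def complex_eq_iff)

lemma qplane_eq_range: "qplane I = range (plane_embed I)"
proof -
  have "of_real a + I * of_real b = plane_embed I (Complex a b)" for a b
    by (simp add: plane_embed_def)
  then have "qplane I \<subseteq> range (plane_embed I)"
    unfolding qplane_def by blast
  moreover have "range (plane_embed I) \<subseteq> qplane I"
    unfolding qplane_def plane_embed_def by blast
  ultimately show ?thesis ..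
qed

lemma linear_plane_embed: "linear (plane_embed I)"
  by (rule linearI) (auto simp: plane_embed_def quat_eq_iff of_real_def algebra_simps)

lemma plane_embed_0 [simp]: "plane_embed I 0 = 0"
  and plane_embed_1 [simp]: "plane_embed I 1 = 1"
  by (simp_all add: plane_embed_def)

lemma plane_embed_coord: "I \<in> imag_sphere \<Longrightarrow> plane_embed I (plane_coord I a) = qproj I a"
  by (simp add: qproj_eq plane_embed_def plane_coord_def)

lemma plane_embed_mult:
  assumes "I \<in> imag_sphere"
  shows "plane_embed I (z * w) = plane_embed I z * plane_embed I w"
proof -
  have "plane_embed I z * plane_embed I w = of_real (Re z * Re w)
      + I * of_real (Re z * Im w + Im z * Re w) + I * I * of_real (Im z * Im w)"
    by (simp add: plane_embed_def of_real_def algebra_simps)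
  then show ?thesis
    by (simp add: imag_sphere_square[OF assms] plane_embed_def)
qed

lemma plane_embed_power:
  "I \<in> imag_sphere \<Longrightarrow> plane_embed I (z ^ n) = plane_embed I z ^ n"
  by (induction n) (simp_all add: plane_embed_mult)

lemma plane_embed_commutes: "I * plane_embed I z = plane_embed I z * I"
  by (simp add: plane_embed_def of_real_def algebra_simps)

text \<open>Multiplying by the image of the conjugate turns the value into the real number
  |z|^2.\<close>

lemma plane_embed_eq_0_iff:
  assumes "I \<in> imag_sphere"
  shows "plane_embed I z = 0 \<longleftrightarrow> z = 0"
proof
  assume "plane_embed I z = 0"
  then have "plane_embed I (cnj z * z) = 0"
    by (simp add: plane_embed_mult[OF assms])
  then have "plane_embed I (of_real ((cmod z)\<^sup>2)) = 0"
    by (simp only: complex_norm_square mult.commute)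
  then have "of_real ((cmod z)\<^sup>2) = (0 :: quat)"
    by (simp add: plane_embed_def del: of_real_power)
  then show "z = 0"
    unfolding of_real_eq_0_iff by simp
qed simp

lemma obtain_plane:
  obtains I z where "I \<in> imag_sphere" "h = plane_embed I z"
proof (cases "h = of_real (qRe h)")
  case True
  have "quat_i \<in> imag_sphere"
    by (simp add: imag_sphere_iff quat_i_def)
  moreover have "h = plane_embed quat_i (of_real (qRe h))"
    using True by (simp add: plane_embed_def)
  ultimately show ?thesis
    by (rule that)
next
  case False
  define v where "v = h - of_real (qRe h)"
  \<comment> \<open>The squared length of the imaginary part \<open>v\<close>, which is then
    normalised to give \<open>I\<close>.\<close>
  define s where "s = (qIm1 h)\<^sup>2 + (qIm2 h)\<^sup>2 + (qIm3 h)\<^sup>2"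
  have "s \<noteq> 0"
    using False by (auto simp: s_def quat_eq_iff of_real_def add_nonneg_eq_0_iff)
  then have s: "s > 0"
    by (simp add: s_def order_less_le)
  define I where "I = v /\<^sub>R sqrt s"
  have comps: "qRe v = 0" "qIm1 v = qIm1 h" "qIm2 v = qIm2 h" "qIm3 v = qIm3 h"
    by (simp_all add: v_def of_real_def)
  have "(qIm1 I)\<^sup>2 + (qIm2 I)\<^sup>2 + (qIm3 I)\<^sup>2 = s / s"
    using s by (simp add: I_def comps power_mult_distrib power_inverse field_simps)
      (simp add: s_def)
  then have "I \<in> imag_sphere"
    using s by (simp add: imag_sphere_iff I_def comps)
  moreover have "h = plane_embed I (Complex (qRe h) (sqrt s))"
    using s by (simp add: plane_embed_def I_def v_def of_real_def)
  ultimately show ?thesis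
    by (rule that)
qed

lemma obtain_anticommuting_unit:
  assumes "I \<in> imag_sphere"
  obtains J where "J \<in> imag_sphere" "I * J = - (J * I)"
proof (cases "qIm1 I = 0 \<and> qIm2 I = 0")
  case True
  \<comment> \<open>Here \<open>I\<close> is k or -k, so i is orthogonal to it.\<close>
  then have "quat_i \<in> imag_sphere" "I * quat_i = - (quat_i * I)"
    using assms by (auto simp: imag_sphere_iff quat_i_def quat_eq_iff)
  then show ?thesis
    by (rule that)
next
  case False
  define s where "s = sqrt ((qIm1 I)\<^sup>2 + (qIm2 I)\<^sup>2)"
  have "s \<noteq> 0" and s2: "s\<^sup>2 = (qIm1 I)\<^sup>2 + (qIm2 I)\<^sup>2"
    using False by (auto simp: s_def add_nonneg_eq_0_iff)
  \<comment> \<open>The i,j-part of \<open>I\<close> turned by a quarter and normalised: orthogonal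
    to \<open>I\<close>, which for imaginary units means anticommuting.\<close>
  define J where "J = Quat 0 (- qIm2 I / s) (qIm1 I / s) 0"
  have "J \<in> imag_sphere"
    using \<open>s \<noteq> 0\<close> by (simp add: imag_sphere_iff J_def power_divide add.commute flip: add_divide_distrib s2)
  moreover have "I * J = - (J * I)"
    using assms by (simp add: imag_sphere_iff J_def quat_eq_iff)
  ultimately show ?thesis
    by (rule that)
qed

text \<open>
  The map \<open>a \<mapsto> - I a I\<close> fixes \<open>\<real>[I]\<close> and is \<open>- 1\<close> on its orthogonal complement, so both
  subspaces are recognised by commutation or anticommutation with \<open>I\<close>.
\<close>

lemma qproj_eq_conj:
  assumes "I \<in> imag_sphere"
  shows "2 *\<^sub>R qproj I a = a - I * a * I"
proof -
  obtain x y z where I: "I = Quat 0 x y z" and 1: "x\<^sup>2 + y\<^sup>2 + z\<^sup>2 = 1"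
    using assms by (cases I) (auto simp: imag_sphere_iff)
  \<comment> \<open>Rewrite rules eliminating \<open>z\<close> through the unit length; the second
    one catches z^2 inside right-nested products.\<close>
  have z2: "z * z = 1 - x * x - y * y" "\<And>c. z * (z * c) = c - x * (x * c) - y * (y * c)"
    using 1 by (simp_all add: power2_eq_square) (algebra)
  show ?thesis
    unfolding qproj_eq[OF assms]
    by (simp add: quat_eq_iff I inner_quat_def of_real_def algebra_simps z2)
qed

lemma qproj_eq_self_iff:
  assumes "I \<in> imag_sphere"
  shows "qproj I a = a \<longleftrightarrow> I * a = a * I"
proof
  assume "I * a = a * I"
  then have "I * a * I = a * (I * I)"
    by (simp add: mult.assoc)
  then have "2 *\<^sub>R qproj I a = 2 *\<^sub>R a"
    unfolding qproj_eq_conj[OF assms] by (simp add: imag_sphere_square[OF assms] scaleR_2)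
  then show "qproj I a = a"
    by simp
next
  assume "qproj I a = a"
  then show "I * a = a * I"
    by (metis plane_embed_coord[OF assms] plane_embed_commutes)
qed

text \<open>Twice the complement is a + I a I; multiplying by I gives I a - a I on the left and a I
  - I a on the right.\<close>

lemma perp_anticommutes:
  assumes "I \<in> imag_sphere"
  shows "I * (a - qproj I a) = - ((a - qproj I a) * I)"
proof -
  have II: "I * I = - 1" "\<And>b. I * (I * b) = - b"
    using imag_sphere_square[OF assms] by (simp_all flip: mult.assoc)
  have w: "2 *\<^sub>R (a - qproj I a) = a + I * a * I"
    unfolding scaleR_diff_right qproj_eq_conj[OF assms] by (simp add: scaleR_2)
  have "I * (a + I * a * I) = - ((a + I * a * I) * I)"
    by (simp add: algebra_simps II)
  then have "2 *\<^sub>R (I * (a - qproj I a)) = 2 *\<^sub>R (- ((a - qproj I a) * I))"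
    unfolding w[symmetric] by simp
  then show ?thesis
    unfolding scaleR_cancel_left by simp
qed

text \<open>Both \<open>J\<close> and w = \<open>a - qproj I a\<close> anticommute with
  \<open>I\<close>, so J w commutes with \<open>I\<close> and lies in R[I]; moreover w = J (- J
  w).\<close>

lemma perp_eq_mult_plane:
  assumes I: "I \<in> imag_sphere" and J: "J \<in> imag_sphere" and IJ: "I * J = - (J * I)"
  shows "J * plane_embed I (plane_coord I (- (J * (a - qproj I a)))) = a - qproj I a"
proof -
  define w where "w = a - qproj I a"
  have "I * (J * w) = - (J * (I * w))"
    by (simp add: IJ flip: mult.assoc)
  also have "\<dots> = J * w * I"
    unfolding w_def perp_anticommutes[OF I] by (simp add: mult.assoc)
  finally have "qproj I (- (J * w)) = - (J * w)"
    by (simp add: qproj_eq_self_iff[OF I])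
  then show ?thesis
    unfolding plane_embed_coord[OF I] w_def[symmetric]
    by (simp add: imag_sphere_square[OF J] flip: mult.assoc)
qed

text \<open>Moving \<open>I\<close> from left to right across x + J y turns it into x - J y, so both
  vanish.\<close>

lemma plane_sum_direct:
  assumes I: "I \<in> imag_sphere" and J: "J \<in> imag_sphere" and IJ: "I * J = - (J * I)"
    and 0: "plane_embed I z + J * plane_embed I w = 0"
  shows "z = 0" "w = 0"
proof -
  let ?x = "plane_embed I z" and ?y = "plane_embed I w"
  have "I * (?x + J * ?y) = (?x - J * ?y) * I"
    by (simp add: distrib_left left_diff_distrib plane_embed_commutes IJ mult.assoc flip: mult.assoc[of I J])
  then have "(?x - J * ?y) * (I * I) = 0"
    using 0 by (simp flip: mult.assoc)
  then have "?x = J * ?y"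
    by (simp add: imag_sphere_square[OF I])
  with 0 have "2 *\<^sub>R ?x = 0"
    by (simp add: scaleR_2)
  then have x: "?x = 0"
    by simp
  then show "z = 0"
    by (simp add: plane_embed_eq_0_iff[OF I])
  have "J * (J * ?y) = 0"
    using 0 x by simp
  then show "w = 0"
    by (simp add: imag_sphere_square[OF J] plane_embed_eq_0_iff[OF I] flip: mult.assoc)
qed

section \<open>Polynomials restricted to a plane\<close>

lemma qeval_bound: "degree Q \<le> N \<Longrightarrow> qeval Q h = (\<Sum>t\<le>N. coeff Q t * h ^ t)"
  unfolding qeval_def by (rule sum.mono_neutral_left) (auto simp: coeff_eq_0)

lemma qeval_add: "qeval (A + B) h = qeval A h + qeval B h"
proof -
  let ?N = "max (degree A) (degree B)"
  have "degree (A + B) \<le> ?N"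
    by (rule degree_add_le_max)
  then show ?thesis
    by (simp add: qeval_bound[of _ ?N] sum.distrib distrib_right)
qed

lemma coeff_qderiv: "coeff (qderiv P) n = of_nat (Suc n) * coeff P (Suc n)"
proof -
  have "coeff (qderiv P) n = (\<Sum>t=1..degree P. if t = Suc n then of_nat t * coeff P t else 0)"
    unfolding qderiv_def coeff_sum by (rule sum.cong) auto
  then show ?thesis
    by (auto simp: coeff_eq_0 not_le)
qed

lemma qpar_add_qperp: "I \<in> imag_sphere \<Longrightarrow> qpar I P + qperp I P = P"
  by (rule poly_eqI) (simp add: qpar_def qperp_def coeff_map_poly qproj_eq)

lemma qderiv_add: "qderiv (A + B) = qderiv A + qderiv B"
  by (rule poly_eqI) (simp add: coeff_qderiv distrib_left)

text \<open>A complex polynomial \<open>q\<close> carried into the plane and multiplied on the left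
  by a constant \<open>K\<close>. The left inverse \<open>L\<close> ensures that \<open>K\<close>
  adds no roots.\<close>

context
  fixes I K L :: quat and Q :: "quat poly" and q :: "complex poly"
  assumes I: "I \<in> imag_sphere" and LK: "L * K = 1"
    and coeff_Q: "\<And>t. coeff Q t = K * plane_embed I (coeff q t)"
begin

lemma left_mult_plane_embed_eq_0_iff: "K * plane_embed I z = 0 \<longleftrightarrow> z = 0"
proof
  assume "K * plane_embed I z = 0"
  then have "L * K * plane_embed I z = 0"
    by (simp add: mult.assoc)
  then show "z = 0"
    by (simp add: LK plane_embed_eq_0_iff[OF I])
qed simp

lemma degree_plane_poly: "degree Q = degree q"
proof (rule antisym)
  show "degree Q \<le> degree q"
    by (rule degree_le) (simp add: coeff_Q coeff_eq_0)
  show "degree q \<le> degree Q"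
    by (rule degree_le) (metis coeff_Q coeff_eq_0 left_mult_plane_embed_eq_0_iff)
qed

lemma qeval_plane_poly: "qeval Q (plane_embed I z) = K * plane_embed I (poly q z)"
  by (simp add: qeval_def poly_altdef degree_plane_poly coeff_Q linear_sum[OF linear_plane_embed]
      plane_embed_mult[OF I] plane_embed_power[OF I] sum_distrib_left mult.assoc)

text \<open>Gauss-Lucas for \<open>q\<close>, transported by a linear map, which commutes with
  convex hulls.\<close>

lemma plane_poly_root_hull:
  assumes z: "poly (pderiv q) z = 0"
  shows "plane_embed I z \<in> root_hull I Q"
proof -
  have roots: "plane_roots I Q = plane_embed I ` {r. poly q r = 0}"
    by (auto simp: plane_roots_def qplane_eq_range qeval_plane_poly
        left_mult_plane_embed_eq_0_iff)
  have "plane_embed I z \<in> convex hull (plane_roots I Q)" if "\<not> (degree Q = 0 \<and> Q \<noteq> 0)"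
  proof -
    have "z \<in> convex hull {r. poly q r = 0}"
    proof (cases "degree q = 0")
      \<comment> \<open>Nonzero constants being excluded, only \<open>q = 0\<close> remains, where
        every point is a root.\<close>
      case True
      then have "Q = 0"
        using that degree_plane_poly by auto
      then have "q = 0"
        by (intro poly_eqI) (metis coeff_0 coeff_Q left_mult_plane_embed_eq_0_iff)
      then show ?thesis
        by (simp add: hull_inc)
    qed (simp add: Gauss_Lucas z)
    then show ?thesis
      unfolding roots by (simp flip: convex_hull_linear_image[OF linear_plane_embed])
  qed
  then show ?thesis
    by (auto simp: root_hull_def qplane_eq_range)
qed

end

text \<open>Natural numbers are central, so differentiation passes through both \<open>K\<close> and
  the embedding.\<close>

lemma qeval_qderiv_plane_poly:
  assumes I: "I \<in> imag_sphere" and LK: "L * K = 1"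
    and coeff_Q: "\<And>t. coeff Q t = K * plane_embed I (coeff q t)"
  shows "qeval (qderiv Q) (plane_embed I z) = K * plane_embed I (poly (pderiv q) z)"
proof (rule qeval_plane_poly[OF I LK])
  fix t
  have "plane_embed I (of_nat (Suc t) * coeff q (Suc t))
      = of_nat (Suc t) * plane_embed I (coeff q (Suc t))"
    using plane_embed_mult[OF I, of "of_nat (Suc t)"]
    by (simp add: plane_embed_def del: of_nat_Suc)
  then show "coeff (qderiv Q) t = K * plane_embed I (coeff (pderiv q) t)"
    unfolding coeff_qderiv coeff_pderiv coeff_Q by (metis mult.assoc mult_of_nat_commute)
qed

theorem theorem1p3:
  fixes P :: "quat poly"
  shows "qroots (qderiv P) \<subseteq>
    (\<Union>I\<in>imag_sphere. root_hull I (qpar I P) \<inter> root_hull I (qperp I P))"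
proof
  fix h
  assume "h \<in> qroots (qderiv P)"
  then have P': "qeval (qderiv P) h = 0"
    by (simp add: qroots_def)
  obtain I z where I: "I \<in> imag_sphere" and h: "h = plane_embed I z"
    by (rule obtain_plane)
  obtain J where J: "J \<in> imag_sphere" and IJ: "I * J = - (J * I)"
    using obtain_anticommuting_unit[OF I] .
  define p where "p = map_poly (plane_coord I) P"
  define q where "q = map_poly (\<lambda>a. plane_coord I (- (J * (a - qproj I a)))) P"
  have proj0: "qproj I 0 = 0"
    by (simp add: qproj_eq[OF I])
  have p: "coeff (qpar I P) t = 1 * plane_embed I (coeff p t)" for t
    by (simp add: qpar_def p_def coeff_map_poly proj0 plane_embed_coord[OF I])
  have q: "coeff (qperp I P) t = J * plane_embed I (coeff q t)" for t
    by (simp add: qperp_def q_def coeff_map_poly proj0 perp_eq_mult_plane[OF I J IJ]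
        del: minus_diff_eq)
  \<comment> \<open>Left inverses for the two factors K = 1 and K = J.\<close>
  have one: "1 * 1 = (1 :: quat)" and JJ: "- J * J = 1"
    by (simp_all add: imag_sphere_square[OF J])
  have "qeval (qderiv (qpar I P)) h + qeval (qderiv (qperp I P)) h = 0"
    using P' by (simp add: qpar_add_qperp[OF I] flip: qeval_add qderiv_add)
  then have "plane_embed I (poly (pderiv p) z) + J * plane_embed I (poly (pderiv q) z) = 0"
    unfolding h qeval_qderiv_plane_poly[OF I one p] qeval_qderiv_plane_poly[OF I JJ q]
    by simp
  from plane_sum_direct[OF I J IJ this]
  have "h \<in> root_hull I (qpar I P)" "h \<in> root_hull I (qperp I P)"
    unfolding h by (simp_all add: plane_poly_root_hull[OF I one p] plane_poly_root_hull[OF I JJ q])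
  with I show "h \<in> (\<Union>I\<in>imag_sphere. root_hull I (qpar I P) \<inter> root_hull I (qperp I P))"
    by blast
qed

end
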